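(* Let $(T,\mu,\eta)$ be an ordered saturation monad on $\mathsf{C}$, let $S:\mathsf{C}\to\mathsf{C}$ be a functor lifting to $\overline{S}:\mathcal{K}l(T)\to\mathcal{K}l(T)$, and let $(\overline{S},m,e)$ be a monad on $\mathcal{K}l(T)$. Assume: $\mathcal{K}l(T)$ is $\omega$-cpo enriched; every hom-set of $\mathcal{K}l(T)$ has finite joins; $\overline{S}$ is locally continuous, i.e. $\overline{S}\bigvee_i f_i=\bigvee_i\overline{S}f_i$ for every chain $f_1\le f_2\le\cdots$; and $1_{\overline{S}X}\vee m_X\cdot\overline{S}\alpha=m_X\cdot\overline{S}(e_X\vee\alpha)$ for every $\alpha:X\rightsquigarrow\overline{S}X$. Then the monad $TS$ is an ordered saturation monad.
   Context: Kleisli category $\mathcal{K}l(T)$: morphisms $X\rightsquigarrow Y$ are morphisms $X\to TY$, composition $g\cdot f=\mu_Z\circ Tg\circ f$, identity $1_X=\eta_X$; $f^\sharp=\eta_Y\circ f$. $\omega$-cpo enriched: hom-sets are posets with composition monotone, every ascending chain has a supremum, and composition preserves such suprema. $S$ lifts to $\overline{S}$ if $\overline{S}X=SX$ and $\overline{S}(f^\sharp)=(Sf)^\sharp$. The monad structure on $TS$ comes from composing the adjunctions $\mathsf{C}\rightleftarrows\mathcal{K}l(T)\rightleftarrows\mathcal{K}l(\overline{S})$: its Kleisli category has $Hom(X,Y)=Hom_{\mathcal{K}l(T)}(X,SY)$, composition $g\bullet f=m_Z\cdot\overline{S}g\cdot f$, identities $e_X$, induced morphisms $e_Y\cdot f^\sharp$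 for $f$ in $\mathsf{C}$, and the order of $\mathcal{K}l(T)$. Ordered saturation monad (for monad $M$ with Kleisli composition $\cdot$, identities $1$, induced morphisms $f^\sharp$): $\mathcal{K}l(M)$ order enriched and for each $\alpha:X\rightsquigarrow X$ there is $\alpha^*$ with (1) $1\le\alpha^*$; (2) $\alpha\le\alpha^*$; (3) $\alpha^*\cdot\alpha^*\le\alpha^*$; (4) $\alpha^*\le\beta$ whenever $1\le\beta$, $\alpha\le\beta$, $\beta\cdot\beta\le\beta$; (5) for $f:X\to Y$ in $\mathsf{C}$ and $\beta:Y\rightsquigarrow Y$, $f^\sharp\cdot\alpha\le\beta\cdot f^\sharp\Rightarrow f^\sharp\cdot\alpha^*\le\beta^*\cdot f^\sharp$, and likewise with $\ge$. *)

theory Defs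
  imports Main
begin

text \<open>
  A category is given by a set of objects and a family of hom-sets. The hom-sets are not required to
  be disjoint, so composition and the action of functors on morphisms carry the objects involved as
  explicit indices. This is what makes Kleisli categories expressible over the same type of
  morphisms: a morphism \<open>X \<rightarrow> T Y\<close> does not determine \<open>Y\<close>.
\<close>

record ('o, 'm) cat =
  Ob :: "'o set"
  Hom :: "'o \<Rightarrow> 'o \<Rightarrow> 'm set"
  Id :: "'o \<Rightarrow> 'm"
  Comp :: "'o \<Rightarrow> 'o \<Rightarrow> 'o \<Rightarrow> 'm \<Rightarrow> 'm \<Rightarrow> 'm"  \<comment> \<open>\<open>Comp C X Y Z g f = g \<circ> f\<close> for \<open>f : X \<rightarrow> Y\<close>, \<open>g : Y \<rightarrow> Z\<close>\<close>

locale category =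
  fixes C :: "('o, 'm) cat"
  assumes Id_in_Hom: "X \<in> Ob C \<Longrightarrow> Id C X \<in> Hom C X X"
    and Comp_in_Hom:
      "\<lbrakk>X \<in> Ob C; Y \<in> Ob C; Z \<in> Ob C; f \<in> Hom C X Y; g \<in> Hom C Y Z\<rbrakk>
        \<Longrightarrow> Comp C X Y Z g f \<in> Hom C X Z"
    and Comp_Id_left:
      "\<lbrakk>X \<in> Ob C; Y \<in> Ob C; f \<in> Hom C X Y\<rbrakk> \<Longrightarrow> Comp C X Y Y (Id C Y) f = f"
    and Comp_Id_right:
      "\<lbrakk>X \<in> Ob C; Y \<in> Ob C; f \<in> Hom C X Y\<rbrakk> \<Longrightarrow> Comp C X X Y f (Id C X) = f"
    and Comp_assoc:
      "\<lbrakk>W \<in> Ob C; X \<in> Ob C; Y \<in> Ob C; Z \<in> Ob C; f \<in> Hom C W X; g \<in> Hom C X Y; h \<in> Hom C Y Z\<rbrakk>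
        \<Longrightarrow> Comp C W X Z (Comp C X Y Z h g) f = Comp C W Y Z h (Comp C W X Y g f)"

record ('o, 'm) functor_data =
  fobj :: "'o \<Rightarrow> 'o"
  farr :: "'o \<Rightarrow> 'o \<Rightarrow> 'm \<Rightarrow> 'm"

record ('o, 'm) monad_data = "('o, 'm) functor_data" +
  mmult :: "'o \<Rightarrow> 'm"
  munit :: "'o \<Rightarrow> 'm"

locale endofunctor = category C
  for C :: "('o, 'm) cat" +
  fixes F :: "('o, 'm, 'z) functor_data_scheme"
  assumes fobj_in_Ob: "X \<in> Ob C \<Longrightarrow> fobj F X \<in> Ob C"
    and farr_in_Hom:
      "\<lbrakk>X \<in> Ob C; Y \<in> Ob C; f \<in> Hom C X Y\<rbrakk> \<Longrightarrow> farr F X Y f \<in> Hom C (fobj F X) (fobj F Y)"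
    and farr_Id: "X \<in> Ob C \<Longrightarrow> farr F X X (Id C X) = Id C (fobj F X)"
    and farr_Comp:
      "\<lbrakk>X \<in> Ob C; Y \<in> Ob C; Z \<in> Ob C; f \<in> Hom C X Y; g \<in> Hom C Y Z\<rbrakk>
        \<Longrightarrow> farr F X Z (Comp C X Y Z g f)
            = Comp C (fobj F X) (fobj F Y) (fobj F Z) (farr F Y Z g) (farr F X Y f)"

locale monad = endofunctor C T
  for C :: "('o, 'm) cat" and T :: "('o, 'm) monad_data" +
  assumes munit_in_Hom: "X \<in> Ob C \<Longrightarrow> munit T X \<in> Hom C X (fobj T X)"
    and mmult_in_Hom: "X \<in> Ob C \<Longrightarrow> mmult T X \<in> Hom C (fobj T (fobj T X)) (fobj T X)"
    and munit_natural:
      "\<lbrakk>X \<in> Ob C; Y \<in> Ob C; f \<in> Hom C X Y\<rbrakk>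
        \<Longrightarrow> Comp C X (fobj T X) (fobj T Y) (farr T X Y f) (munit T X)
            = Comp C X Y (fobj T Y) (munit T Y) f"
    and mmult_natural:
      "\<lbrakk>X \<in> Ob C; Y \<in> Ob C; f \<in> Hom C X Y\<rbrakk>
        \<Longrightarrow> Comp C (fobj T (fobj T X)) (fobj T X) (fobj T Y) (farr T X Y f) (mmult T X)
            = Comp C (fobj T (fobj T X)) (fobj T (fobj T Y)) (fobj T Y)
                (mmult T Y) (farr T (fobj T X) (fobj T Y) (farr T X Y f))"
    and mmult_assoc:
      "X \<in> Ob C
        \<Longrightarrow> Comp C (fobj T (fobj T (fobj T X))) (fobj T (fobj T X)) (fobj T X)
              (mmult T X) (farr T (fobj T (fobj T X)) (fobj T X) (mmult T X))
            = Comp C (fobj T (fobj T (fobj T X))) (fobj T (fobj T X)) (fobj T X)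
                (mmult T X) (mmult T (fobj T X))"
    and mmult_munit_left:
      "X \<in> Ob C
        \<Longrightarrow> Comp C (fobj T X) (fobj T (fobj T X)) (fobj T X) (mmult T X) (munit T (fobj T X))
            = Id C (fobj T X)"
    and mmult_munit_right:
      "X \<in> Ob C
        \<Longrightarrow> Comp C (fobj T X) (fobj T (fobj T X)) (fobj T X)
              (mmult T X) (farr T X (fobj T X) (munit T X))
            = Id C (fobj T X)"

definition Kleisli :: "('o, 'm) cat \<Rightarrow> ('o, 'm) monad_data \<Rightarrow> ('o, 'm) cat" where
  "Kleisli C T =
    \<lparr> Ob = Ob C,
      Hom = (\<lambda>X Y. Hom C X (fobj T Y)),
      Id = munit T,
      Comp = (\<lambda>X Y Z g f.
        Comp C X (fobj T Y) (fobj T Z)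
          (Comp C (fobj T Y) (fobj T (fobj T Z)) (fobj T Z) (mmult T Z) (farr T Y (fobj T Z) g)) f) \<rparr>"

definition sharp :: "('o, 'm) cat \<Rightarrow> ('o, 'm) monad_data \<Rightarrow> 'o \<Rightarrow> 'o \<Rightarrow> 'm \<Rightarrow> 'm" where
  "sharp C T X Y f = Comp C X Y (fobj T Y) (munit T Y) f"

definition lifts_to ::
  "('o, 'm) cat \<Rightarrow> ('o, 'm) monad_data \<Rightarrow> ('o, 'm, 'y) functor_data_scheme
    \<Rightarrow> ('o, 'm, 'z) functor_data_scheme \<Rightarrow> bool" where
  "lifts_to C T S Sb \<longleftrightarrow>
    (\<forall>X \<in> Ob C. fobj Sb X = fobj S X) \<and>
    (\<forall>X \<in> Ob C. \<forall>Y \<in> Ob C. \<forall>f \<in> Hom C X Y.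
      farr Sb X Y (sharp C T X Y f) = sharp C T (fobj S X) (fobj S Y) (farr S X Y f))"

locale order_enriched = category K
  for K :: "('o, 'm) cat" +
  fixes le :: "'o \<Rightarrow> 'o \<Rightarrow> 'm \<Rightarrow> 'm \<Rightarrow> bool"
  assumes le_refl: "\<lbrakk>X \<in> Ob K; Y \<in> Ob K\<rbrakk> \<Longrightarrow> reflp_on (Hom K X Y) (le X Y)"
    and le_trans: "\<lbrakk>X \<in> Ob K; Y \<in> Ob K\<rbrakk> \<Longrightarrow> transp_on (Hom K X Y) (le X Y)"
    and le_antisym: "\<lbrakk>X \<in> Ob K; Y \<in> Ob K\<rbrakk> \<Longrightarrow> antisymp_on (Hom K X Y) (le X Y)"
    and Comp_mono:
      "\<lbrakk>X \<in> Ob K; Y \<in> Ob K; Z \<in> Ob K; f \<in> Hom K X Y; f' \<in> Hom K X Y; g \<in> Hom K Y Z; g' \<in> Hom K Y Z;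
        le X Y f f'; le Y Z g g'\<rbrakk>
        \<Longrightarrow> le X Z (Comp K X Y Z g f) (Comp K X Y Z g' f')"

definition is_lub ::
  "('o, 'm) cat \<Rightarrow> ('o \<Rightarrow> 'o \<Rightarrow> 'm \<Rightarrow> 'm \<Rightarrow> bool) \<Rightarrow> 'o \<Rightarrow> 'o \<Rightarrow> 'm set \<Rightarrow> 'm \<Rightarrow> bool" where
  "is_lub K le X Y A s \<longleftrightarrow>
    s \<in> Hom K X Y \<and> (\<forall>a \<in> A. le X Y a s) \<and>
    (\<forall>u \<in> Hom K X Y. (\<forall>a \<in> A. le X Y a u) \<longrightarrow> le X Y s u)"

definition join ::
  "('o, 'm) cat \<Rightarrow> ('o \<Rightarrow> 'o \<Rightarrow> 'm \<Rightarrow> 'm \<Rightarrow> bool) \<Rightarrow> 'o \<Rightarrow> 'o \<Rightarrow> 'm \<Rightarrow> 'm \<Rightarrow> 'm" where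
  "join K le X Y f g = (THE s. is_lub K le X Y {f, g} s)"

definition ascending_chain ::
  "('o, 'm) cat \<Rightarrow> ('o \<Rightarrow> 'o \<Rightarrow> 'm \<Rightarrow> 'm \<Rightarrow> bool) \<Rightarrow> 'o \<Rightarrow> 'o \<Rightarrow> (nat \<Rightarrow> 'm) \<Rightarrow> bool" where
  "ascending_chain K le X Y f \<longleftrightarrow> (\<forall>i. f i \<in> Hom K X Y \<and> le X Y (f i) (f (Suc i)))"

locale omega_cpo_enriched = order_enriched K le
  for K :: "('o, 'm) cat" and le :: "'o \<Rightarrow> 'o \<Rightarrow> 'm \<Rightarrow> 'm \<Rightarrow> bool" +
  assumes chain_has_lub:
      "\<lbrakk>X \<in> Ob K; Y \<in> Ob K; ascending_chain K le X Y c\<rbrakk> \<Longrightarrow> \<exists>s. is_lub K le X Y (range c) s"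
    and Comp_lub_left:
      "\<lbrakk>X \<in> Ob K; Y \<in> Ob K; Z \<in> Ob K; f \<in> Hom K X Y;
        ascending_chain K le Y Z c; is_lub K le Y Z (range c) s\<rbrakk>
        \<Longrightarrow> is_lub K le X Z (range (\<lambda>i. Comp K X Y Z (c i) f)) (Comp K X Y Z s f)"
    and Comp_lub_right:
      "\<lbrakk>X \<in> Ob K; Y \<in> Ob K; Z \<in> Ob K; g \<in> Hom K Y Z;
        ascending_chain K le X Y c; is_lub K le X Y (range c) s\<rbrakk>
        \<Longrightarrow> is_lub K le X Z (range (\<lambda>i. Comp K X Y Z g (c i))) (Comp K X Y Z g s)"

definition has_finite_joins ::
  "('o, 'm) cat \<Rightarrow> ('o \<Rightarrow> 'o \<Rightarrow> 'm \<Rightarrow> 'm \<Rightarrow> bool) \<Rightarrow> bool" where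
  "has_finite_joins K le \<longleftrightarrow>
    (\<forall>X \<in> Ob K. \<forall>Y \<in> Ob K. \<forall>A. finite A \<and> A \<subseteq> Hom K X Y \<longrightarrow> (\<exists>s. is_lub K le X Y A s))"

definition locally_continuous ::
  "('o, 'm) cat \<Rightarrow> ('o \<Rightarrow> 'o \<Rightarrow> 'm \<Rightarrow> 'm \<Rightarrow> bool) \<Rightarrow> ('o, 'm, 'z) functor_data_scheme \<Rightarrow> bool" where
  "locally_continuous K le F \<longleftrightarrow>
    (\<forall>X \<in> Ob K. \<forall>Y \<in> Ob K. \<forall>f s.
      ascending_chain K le X Y f \<and> is_lub K le X Y (range f) s \<longrightarrow>
        is_lub K le (fobj F X) (fobj F Y) (range (\<lambda>i. farr F X Y (f i))) (farr F X Y s))"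

text \<open>\<open>star X\<close> is the saturation operator on the endomorphisms of \<open>X\<close>.\<close>

definition saturation_operator ::
  "('o, 'm) cat \<Rightarrow> ('o, 'm) monad_data \<Rightarrow> ('o \<Rightarrow> 'o \<Rightarrow> 'm \<Rightarrow> 'm \<Rightarrow> bool) \<Rightarrow> ('o \<Rightarrow> 'm \<Rightarrow> 'm) \<Rightarrow> bool" where
  "saturation_operator C M le star \<longleftrightarrow>
    (let K = Kleisli C M in
      (\<forall>X \<in> Ob C. \<forall>\<alpha> \<in> Hom K X X.
        star X \<alpha> \<in> Hom K X X \<and>
        le X X (Id K X) (star X \<alpha>) \<and>
        le X X \<alpha> (star X \<alpha>) \<and>
        le X X (Comp K X X X (star X \<alpha>) (star X \<alpha>)) (star X \<alpha>) \<and>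
        (\<forall>\<beta> \<in> Hom K X X.
          le X X (Id K X) \<beta> \<and> le X X \<alpha> \<beta> \<and> le X X (Comp K X X X \<beta> \<beta>) \<beta> \<longrightarrow> le X X (star X \<alpha>) \<beta>)) \<and>
      (\<forall>X \<in> Ob C. \<forall>Y \<in> Ob C. \<forall>f \<in> Hom C X Y. \<forall>\<alpha> \<in> Hom K X X. \<forall>\<beta> \<in> Hom K Y Y.
        (le X Y (Comp K X X Y (sharp C M X Y f) \<alpha>) (Comp K X Y Y \<beta> (sharp C M X Y f)) \<longrightarrow>
          le X Y (Comp K X X Y (sharp C M X Y f) (star X \<alpha>))
                 (Comp K X Y Y (star Y \<beta>) (sharp C M X Y f))) \<and>
        (le X Y (Comp K X Y Y \<beta> (sharp C M X Y f)) (Comp K X X Y (sharp C M X Y f) \<alpha>) \<longrightarrow>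
          le X Y (Comp K X Y Y (star Y \<beta>) (sharp C M X Y f))
                 (Comp K X X Y (sharp C M X Y f) (star X \<alpha>)))))"

locale ordered_saturation_monad = monad C M + order_enriched "Kleisli C M" le
  for C :: "('o, 'm) cat" and M :: "('o, 'm) monad_data"
    and le :: "'o \<Rightarrow> 'o \<Rightarrow> 'm \<Rightarrow> 'm \<Rightarrow> bool" +
  assumes has_saturation: "\<exists>star. saturation_operator C M le star"

text \<open>
  The monad of the composite adjunction from \<open>C\<close> via \<open>Kleisli C T\<close> to \<open>Kleisli (Kleisli C T) Sb\<close>.
  Its counit at \<open>X\<close> is the identity of \<open>T (S X)\<close>, read as a morphism from \<open>T (S X)\<close> to \<open>S X\<close> in
  \<open>Kleisli C T\<close>. The right adjoint sends a morphism \<open>g\<close> to \<open>\<mu> \<circ> T (m \<cdot> Sb g)\<close>; applied to the counit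
  it yields the multiplication below.
\<close>

definition composite_monad ::
  "('o, 'm) cat \<Rightarrow> ('o, 'm) monad_data \<Rightarrow> ('o, 'm) functor_data \<Rightarrow> ('o, 'm) monad_data
    \<Rightarrow> ('o, 'm) monad_data" where
  "composite_monad C T S Sb =
    \<lparr> fobj = (\<lambda>X. fobj T (fobj S X)),
      farr = (\<lambda>X Y f. farr T (fobj S X) (fobj S Y) (farr S X Y f)),
      mmult = (\<lambda>X. let TSX = fobj T (fobj S X); STSX = fobj S TSX; SSX = fobj S (fobj S X) in
        Comp C (fobj T STSX) (fobj T (fobj T (fobj S X))) TSX
          (mmult T (fobj S X))
          (farr T STSX TSX
            (Comp (Kleisli C T) STSX SSX (fobj S X)
              (mmult Sb X) (farr Sb TSX (fobj S X) (Id C TSX))))),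
      munit = munit Sb \<rparr>"

text \<open>
  The next facts confirm that the Kleisli category of the composite monad is the expected one:
  composition is \<open>m \<cdot> Sb g \<cdot> f\<close>, identities are those of \<open>Sb\<close>, and a morphism \<open>f\<close> of \<open>C\<close> induces
  \<open>e \<cdot> f\<^sup>\<sharp>\<close>.
\<close>

lemma Kleisli_simps:
  "Ob (Kleisli C T) = Ob C"
  "Hom (Kleisli C T) X Y = Hom C X (fobj T Y)"
  "Id (Kleisli C T) = munit T"
  "Comp (Kleisli C T) X Y Z g f =
    Comp C X (fobj T Y) (fobj T Z)
      (Comp C (fobj T Y) (fobj T (fobj T Z)) (fobj T Z) (mmult T Z) (farr T Y (fobj T Z) g)) f"
  by (simp_all add: Kleisli_def)

lemma Hom_Kleisli_composite_monad:
  "Hom (Kleisli C (composite_monad C T S Sb)) X Y = Hom (Kleisli C T) X (fobj S Y)"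
  by (simp add: Kleisli_simps composite_monad_def)

lemma Id_Kleisli_composite_monad:
  "Id (Kleisli C (composite_monad C T S Sb)) X = munit Sb X"
  by (simp add: Kleisli_simps composite_monad_def)

lemma (in monad) Kleisli_Comp_sharp:
  assumes "X \<in> Ob C" "Y \<in> Ob C" "Z \<in> Ob C" "f \<in> Hom C X Y" "g \<in> Hom C Y (fobj T Z)"
  shows "Comp (Kleisli C T) X Y Z g (sharp C T X Y f) = Comp C X Y (fobj T Z) g f"
proof -
  let ?TZ = "fobj T Z" and ?TTZ = "fobj T (fobj T Z)" and ?TY = "fobj T Y"
  note ob = assms(1-3) fobj_in_Ob[OF assms(2)] fobj_in_Ob[OF assms(3)]
    fobj_in_Ob[OF fobj_in_Ob[OF assms(3)]]
  have Tg: "farr T Y ?TZ g \<in> Hom C ?TY ?TTZ" using ob assms by (simp add: farr_in_Hom)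
  have mu: "mmult T Z \<in> Hom C ?TTZ ?TZ" "munit T ?TZ \<in> Hom C ?TZ ?TTZ" "munit T Y \<in> Hom C Y ?TY"
    using ob by (simp_all add: mmult_in_Hom munit_in_Hom)
  let ?h = "Comp C ?TY ?TTZ ?TZ (mmult T Z) (farr T Y ?TZ g)"
  have h: "?h \<in> Hom C ?TY ?TZ" by (rule Comp_in_Hom) (use ob Tg mu in auto)
  have "Comp C Y ?TY ?TZ ?h (munit T Y)
      = Comp C Y ?TTZ ?TZ (mmult T Z) (Comp C Y ?TY ?TTZ (farr T Y ?TZ g) (munit T Y))"
    by (rule Comp_assoc) (use ob Tg mu in auto)
  also have "\<dots> = Comp C Y ?TTZ ?TZ (mmult T Z) (Comp C Y ?TZ ?TTZ (munit T ?TZ) g)"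
    using munit_natural[of Y ?TZ g] ob assms by simp
  also have "\<dots> = Comp C Y ?TZ ?TZ (Comp C ?TZ ?TTZ ?TZ (mmult T Z) (munit T ?TZ)) g"
    by (rule Comp_assoc[symmetric]) (use ob assms mu in auto)
  also have "\<dots> = g" using ob assms by (simp add: mmult_munit_left Comp_Id_left)
  finally have *: "Comp C Y ?TY ?TZ ?h (munit T Y) = g" .
  have "Comp C X ?TY ?TZ ?h (Comp C X Y ?TY (munit T Y) f)
      = Comp C X Y ?TZ (Comp C Y ?TY ?TZ ?h (munit T Y)) f"
    by (rule Comp_assoc[symmetric]) (use ob assms mu h in auto)
  then show ?thesis by (simp add: * Kleisli_simps sharp_def)
qed

lemma sharp_composite_monad:
  assumes "monad C T" "monad (Kleisli C T) Sb" "lifts_to C T S Sb"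
    and "X \<in> Ob C" "Y \<in> Ob C" "f \<in> Hom C X Y"
  shows "sharp C (composite_monad C T S Sb) X Y f
    = Comp (Kleisli C T) X Y (fobj S Y) (munit Sb Y) (sharp C T X Y f)"
proof -
  interpret T: monad C T by fact
  interpret Sb: monad "Kleisli C T" Sb by fact
  have "fobj Sb Y = fobj S Y" using assms by (simp add: lifts_to_def)
  moreover have "fobj S Y \<in> Ob C" "munit Sb Y \<in> Hom C Y (fobj T (fobj S Y))"
    using Sb.fobj_in_Ob[of Y] Sb.munit_in_Hom[of Y] assms calculation by (simp_all add: Kleisli_simps)
  ultimately show ?thesis
    using assms by (simp add: T.Kleisli_Comp_sharp) (simp add: sharp_def composite_monad_def)
qed

lemma Comp_Kleisli_composite_monad:
  assumes "monad C T" "endofunctor C S" "monad (Kleisli C T) Sb" "lifts_to C T S Sb"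
    and ob: "X \<in> Ob C" "Y \<in> Ob C" "Z \<in> Ob C"
    and f: "f \<in> Hom (Kleisli C T) X (fobj S Y)" and g: "g \<in> Hom (Kleisli C T) Y (fobj S Z)"
  shows "Comp (Kleisli C (composite_monad C T S Sb)) X Y Z g f
    = Comp (Kleisli C T) X (fobj S Y) (fobj S Z)
        (Comp (Kleisli C T) (fobj S Y) (fobj S (fobj S Z)) (fobj S Z)
          (mmult Sb Z) (farr Sb Y (fobj S Z) g)) f"
proof -
  interpret T: monad C T by fact
  interpret S: endofunctor C S by fact
  interpret Sb: monad "Kleisli C T" Sb by fact
  let ?K = "Kleisli C T"
  let ?SZ = "fobj S Z" and ?SY = "fobj S Y"
  let ?TSZ = "fobj T ?SZ" and ?SSZ = "fobj S ?SZ"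
  let ?STSZ = "fobj S ?TSZ"
  have obs: "?SZ \<in> Ob C" "?SY \<in> Ob C" "?TSZ \<in> Ob C" "?SSZ \<in> Ob C" "?STSZ \<in> Ob C"
    using ob by (simp_all add: S.fobj_in_Ob T.fobj_in_Ob)
  have K: "Ob ?K = Ob C" "\<And>A B. Hom ?K A B = Hom C A (fobj T B)" by (simp_all add: Kleisli_simps)
  have Sb_S: "fobj Sb A = fobj S A" if "A \<in> Ob C" for A
    using that assms by (simp add: lifts_to_def)
  have gC: "g \<in> Hom C Y ?TSZ" using g by (simp add: K)
  have Sg: "farr S Y ?TSZ g \<in> Hom C ?SY ?STSZ" using gC ob obs by (simp add: S.farr_in_Hom)
  define i where "i = farr Sb ?TSZ ?SZ (Id C ?TSZ)"
  have id: "Id C ?TSZ \<in> Hom ?K ?TSZ ?SZ" using obs by (simp add: K T.Id_in_Hom)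
  have i: "i \<in> Hom ?K ?STSZ ?SSZ"
    using Sb.farr_in_Hom[OF _ _ id] obs by (simp add: K Sb_S i_def)
  have sg: "sharp C T Y ?TSZ g \<in> Hom ?K Y ?TSZ"
    unfolding sharp_def K by (rule T.Comp_in_Hom) (use ob obs gC in \<open>auto simp: T.fobj_in_Ob T.munit_in_Hom\<close>)
  have sSg: "sharp C T ?SY ?STSZ (farr S Y ?TSZ g) \<in> Hom ?K ?SY ?STSZ"
    unfolding sharp_def K by (rule T.Comp_in_Hom) (use ob obs Sg in \<open>auto simp: T.fobj_in_Ob T.munit_in_Hom\<close>)
  have m: "mmult Sb Z \<in> Hom ?K ?SSZ ?SZ"
    using Sb.mmult_in_Hom[of Z] ob obs by (simp add: K Sb_S)
  define p where "p = Comp ?K ?STSZ ?SSZ ?SZ (mmult Sb Z) i"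
  have p: "p \<in> Hom C ?STSZ ?TSZ"
    using Sb.Comp_in_Hom[of ?STSZ ?SSZ ?SZ i "mmult Sb Z"] i m obs by (simp add: K p_def)
  have "g = Comp ?K Y ?TSZ ?SZ (Id C ?TSZ) (sharp C T Y ?TSZ g)"
    using T.Kleisli_Comp_sharp[of Y ?TSZ ?SZ g "Id C ?TSZ"] ob obs gC
    by (simp add: T.Id_in_Hom T.Comp_Id_left)
  then have "farr Sb Y ?SZ g = Comp ?K ?SY ?STSZ ?SSZ i (farr Sb Y ?TSZ (sharp C T Y ?TSZ g))"
    using Sb.farr_Comp[OF _ _ _ sg id] ob obs by (simp add: K Sb_S i_def)
  also have "farr Sb Y ?TSZ (sharp C T Y ?TSZ g) = sharp C T ?SY ?STSZ (farr S Y ?TSZ g)"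
    using assms(4) ob obs gC by (simp add: lifts_to_def)
  finally have Sbg: "farr Sb Y ?SZ g
    = Comp ?K ?SY ?STSZ ?SSZ i (sharp C T ?SY ?STSZ (farr S Y ?TSZ g))" .
  have "Comp ?K ?SY ?SSZ ?SZ (mmult Sb Z) (farr Sb Y ?SZ g)
      = Comp ?K ?SY ?STSZ ?SZ p (sharp C T ?SY ?STSZ (farr S Y ?TSZ g))"
    unfolding Sbg p_def by (rule Sb.Comp_assoc[symmetric]) (use obs i m sSg in \<open>auto simp: K(1)\<close>)
  also have "\<dots> = Comp C ?SY ?STSZ ?TSZ p (farr S Y ?TSZ g)"
    by (rule T.Kleisli_Comp_sharp) (use obs Sg p in auto)
  finally have q: "Comp ?K ?SY ?SSZ ?SZ (mmult Sb Z) (farr Sb Y ?SZ g)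
      = Comp C ?SY ?STSZ ?TSZ p (farr S Y ?TSZ g)" .
  have "Comp C (fobj T ?SY) (fobj T ?STSZ) ?TSZ
          (Comp C (fobj T ?STSZ) (fobj T ?TSZ) ?TSZ (mmult T ?SZ) (farr T ?STSZ ?TSZ p))
          (farr T ?SY ?STSZ (farr S Y ?TSZ g))
      = Comp C (fobj T ?SY) (fobj T ?TSZ) ?TSZ (mmult T ?SZ)
          (Comp C (fobj T ?SY) (fobj T ?STSZ) (fobj T ?TSZ)
            (farr T ?STSZ ?TSZ p) (farr T ?SY ?STSZ (farr S Y ?TSZ g)))"
    by (rule T.Comp_assoc)
      (use obs Sg p in \<open>auto simp: T.fobj_in_Ob T.farr_in_Hom T.mmult_in_Hom\<close>)
  also have "Comp C (fobj T ?SY) (fobj T ?STSZ) (fobj T ?TSZ)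
            (farr T ?STSZ ?TSZ p) (farr T ?SY ?STSZ (farr S Y ?TSZ g))
      = farr T ?SY ?TSZ (Comp C ?SY ?STSZ ?TSZ p (farr S Y ?TSZ g))"
    by (rule T.farr_Comp[symmetric]) (use obs Sg p in auto)
  finally show ?thesis
    unfolding q unfolding Kleisli_simps(4)[of C "composite_monad C T S Sb"] Kleisli_simps(4)[of C T X]
    by (simp add: composite_monad_def Let_def p_def i_def)
qed

end

theory Submission
  imports Defs
begin

text \<open>
  In an \<open>\<omega>\<close>-cpo enriched category with finite joins, the saturation of an endomorphism \<open>\<alpha>\<close> is the
  supremum of the powers of \<open>1 \<or> \<alpha>\<close>. Local continuity of \<open>Sb\<close> makes the Kleisli category of \<open>Sb\<close>
  \<open>\<omega>\<close>-cpo enriched too, so saturations exist there. As joins need not be preserved by composition, the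
  compatibility with morphisms of \<open>C\<close> is inherited from \<open>T\<close> instead: Kleisli extension
  \<open>\<alpha> \<mapsto> m \<cdot> Sb \<alpha>\<close> preserves composition and suprema of chains and sends \<open>e \<or> \<alpha>\<close> to \<open>1 \<or> m \<cdot> Sb \<alpha>\<close>, hence
  it sends the saturation of \<open>\<alpha>\<close> to the saturation of \<open>m \<cdot> Sb \<alpha>\<close>, and precomposition with the unit
  undoes the extension.
\<close>

section \<open>Kleisli extension\<close>

text \<open>The extension operator \<open>\<mu> \<circ> T g\<close> of the Kleisli triple. For the
  monad \<open>Sb\<close> on \<open>Kleisli C T\<close> it is the morphism
  \<open>m \<cdot> Sb g\<close> of the join hypothesis.\<close>

definition kext :: "('o, 'm) cat \<Rightarrow> ('o, 'm) monad_data \<Rightarrow> 'o \<Rightarrow> 'o \<Rightarrow> 'm \<Rightarrow> 'm" where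
  "kext C T X Y g =
    Comp C (fobj T X) (fobj T (fobj T Y)) (fobj T Y) (mmult T Y) (farr T X (fobj T Y) g)"

lemma Comp_Kleisli_kext:
  "Comp (Kleisli C T) X Y Z g f = Comp C X (fobj T Y) (fobj T Z) (kext C T Y Z g) f"
  by (simp add: Kleisli_simps kext_def)

context monad
begin

lemma kext_in_Hom:
  "\<lbrakk>X \<in> Ob C; Y \<in> Ob C; g \<in> Hom C X (fobj T Y)\<rbrakk> \<Longrightarrow> kext C T X Y g \<in> Hom C (fobj T X) (fobj T Y)"
  unfolding kext_def
  by (rule Comp_in_Hom) (auto simp: fobj_in_Ob farr_in_Hom mmult_in_Hom)

lemma kext_munit: "X \<in> Ob C \<Longrightarrow> kext C T X X (munit T X) = Id C (fobj T X)"
  by (simp add: kext_def mmult_munit_right)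

lemma sharp_in_Hom:
  "\<lbrakk>X \<in> Ob C; Y \<in> Ob C; f \<in> Hom C X Y\<rbrakk> \<Longrightarrow> sharp C T X Y f \<in> Hom C X (fobj T Y)"
  unfolding sharp_def by (rule Comp_in_Hom) (auto simp: fobj_in_Ob munit_in_Hom)

text \<open>Functoriality splits \<open>T (\<eta> \<circ> f)\<close>, and the unit law for
  \<open>\<mu> \<circ> T \<eta>\<close> removes the unit.\<close>

lemma kext_sharp:
  assumes "X \<in> Ob C" "Y \<in> Ob C" "f \<in> Hom C X Y"
  shows "kext C T X Y (sharp C T X Y f) = farr T X Y f"
proof -
  let ?TX = "fobj T X" and ?TY = "fobj T Y" and ?TTY = "fobj T (fobj T Y)"
  note ob = assms(1,2) fobj_in_Ob[OF assms(1)] fobj_in_Ob[OF assms(2)]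
    fobj_in_Ob[OF fobj_in_Ob[OF assms(2)]]
  have "kext C T X Y (sharp C T X Y f)
      = Comp C ?TX ?TTY ?TY (mmult T Y)
          (Comp C ?TX ?TY ?TTY (farr T Y ?TY (munit T Y)) (farr T X Y f))"
    unfolding kext_def sharp_def
    by (subst farr_Comp) (use ob assms in \<open>auto simp: munit_in_Hom\<close>)
  also have "\<dots> = Comp C ?TX ?TY ?TY
      (Comp C ?TY ?TTY ?TY (mmult T Y) (farr T Y ?TY (munit T Y))) (farr T X Y f)"
    by (rule Comp_assoc[symmetric])
      (use ob assms in \<open>auto simp: munit_in_Hom mmult_in_Hom farr_in_Hom\<close>)
  also have "\<dots> = farr T X Y f"
    using ob assms by (simp add: mmult_munit_right Comp_Id_left farr_in_Hom)
  finally show ?thesis .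
qed

text \<open>The unit is the induced morphism of an identity, so this is a case of
  \<open>Kleisli_Comp_sharp\<close>. It provides the left inverse of \<open>kext\<close> that makes
  extension reflect the order.\<close>

lemma Comp_kext_munit:
  assumes "X \<in> Ob C" "Y \<in> Ob C" "g \<in> Hom C X (fobj T Y)"
  shows "Comp C X (fobj T X) (fobj T Y) (kext C T X Y g) (munit T X) = g"
proof -
  have "sharp C T X X (Id C X) = munit T X"
    unfolding sharp_def using assms by (simp add: Comp_Id_right munit_in_Hom fobj_in_Ob)
  then show ?thesis
    using Kleisli_Comp_sharp[of X X Y "Id C X" g] assms
    by (simp add: Comp_Kleisli_kext Id_in_Hom Comp_Id_right fobj_in_Ob)
qed

text \<open>Extension is multiplicative because an extended morphism is a homomorphism of free
  algebras, which is the fact \<open>nat\<close> in the proof.\<close>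

lemma kext_Comp_kext:
  assumes "X \<in> Ob C" "Y \<in> Ob C" "Z \<in> Ob C" "f \<in> Hom C X (fobj T Y)" "g \<in> Hom C Y (fobj T Z)"
  shows "kext C T X Z (Comp C X (fobj T Y) (fobj T Z) (kext C T Y Z g) f)
    = Comp C (fobj T X) (fobj T Y) (fobj T Z) (kext C T Y Z g) (kext C T X Y f)"
proof -
  let ?TX = "fobj T X" and ?TY = "fobj T Y" and ?TTY = "fobj T (fobj T Y)"
    and ?TZ = "fobj T Z" and ?TTZ = "fobj T (fobj T Z)" and ?TTTZ = "fobj T (fobj T (fobj T Z))"
  let ?Tf = "farr T X ?TY f" and ?Tg = "farr T Y ?TZ g" and ?TTg = "farr T ?TY ?TTZ (farr T Y ?TZ g)"
  have ob: "?TX \<in> Ob C" "?TY \<in> Ob C" "?TTY \<in> Ob C" "?TZ \<in> Ob C" "?TTZ \<in> Ob C" "?TTTZ \<in> Ob C"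
    using assms by (simp_all add: fobj_in_Ob)
  have Tf: "?Tf \<in> Hom C ?TX ?TTY" using ob assms by (simp add: farr_in_Hom)
  have Tg: "?Tg \<in> Hom C ?TY ?TTZ" using ob assms by (simp add: farr_in_Hom)
  have TTg: "?TTg \<in> Hom C ?TTY ?TTTZ" using ob Tg by (simp add: farr_in_Hom)
  have mu: "mmult T Z \<in> Hom C ?TTZ ?TZ" "mmult T Y \<in> Hom C ?TTY ?TY"
    "mmult T ?TZ \<in> Hom C ?TTTZ ?TTZ" "farr T ?TTZ ?TZ (mmult T Z) \<in> Hom C ?TTTZ ?TTZ"
    using ob assms by (simp_all add: mmult_in_Hom farr_in_Hom)
  have h: "kext C T Y Z g \<in> Hom C ?TY ?TZ" using assms by (simp add: kext_in_Hom)
  \<comment> \<open>Towards \<open>nat\<close>: associativity trades \<open>T \<mu>\<close> for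
    \<open>\<mu>\<close> at \<open>?TZ\<close>, and naturality then moves that \<open>\<mu>\<close>
    past \<open>T (T g)\<close>.\<close>
  have "farr T ?TY ?TZ (kext C T Y Z g)
      = Comp C ?TTY ?TTTZ ?TTZ (farr T ?TTZ ?TZ (mmult T Z)) ?TTg"
    unfolding kext_def using ob Tg mu by (intro farr_Comp) auto
  then have "Comp C ?TTY ?TTZ ?TZ (mmult T Z) (farr T ?TY ?TZ (kext C T Y Z g))
      = Comp C ?TTY ?TTTZ ?TZ
          (Comp C ?TTTZ ?TTZ ?TZ (mmult T Z) (farr T ?TTZ ?TZ (mmult T Z))) ?TTg"
    using Comp_assoc[OF _ _ _ _ TTg mu(4) mu(1)] ob by simp
  also have "\<dots> = Comp C ?TTY ?TTTZ ?TZ (Comp C ?TTTZ ?TTZ ?TZ (mmult T Z) (mmult T ?TZ)) ?TTg"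
    using assms by (simp add: mmult_assoc)
  also have "\<dots> = Comp C ?TTY ?TTZ ?TZ (mmult T Z) (Comp C ?TTY ?TTTZ ?TTZ (mmult T ?TZ) ?TTg)"
    using ob TTg mu by (intro Comp_assoc) auto
  also have "Comp C ?TTY ?TTTZ ?TTZ (mmult T ?TZ) ?TTg = Comp C ?TTY ?TY ?TTZ ?Tg (mmult T Y)"
    using ob assms by (simp add: mmult_natural)
  also have "Comp C ?TTY ?TTZ ?TZ (mmult T Z) (Comp C ?TTY ?TY ?TTZ ?Tg (mmult T Y))
      = Comp C ?TTY ?TY ?TZ (kext C T Y Z g) (mmult T Y)"
    unfolding kext_def using ob Tg mu by (intro Comp_assoc[symmetric]) auto
  finally have nat: "Comp C ?TTY ?TTZ ?TZ (mmult T Z) (farr T ?TY ?TZ (kext C T Y Z g))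
      = Comp C ?TTY ?TY ?TZ (kext C T Y Z g) (mmult T Y)" .
  have "kext C T X Z (Comp C X ?TY ?TZ (kext C T Y Z g) f)
      = Comp C ?TX ?TTZ ?TZ (mmult T Z) (Comp C ?TX ?TTY ?TTZ (farr T ?TY ?TZ (kext C T Y Z g)) ?Tf)"
    unfolding kext_def[of C T X Z] using ob assms h by (simp add: farr_Comp)
  also have "\<dots> = Comp C ?TX ?TTY ?TZ
      (Comp C ?TTY ?TTZ ?TZ (mmult T Z) (farr T ?TY ?TZ (kext C T Y Z g))) ?Tf"
    using ob Tf mu h by (intro Comp_assoc[symmetric]) (auto simp: farr_in_Hom)
  also have "\<dots> = Comp C ?TX ?TY ?TZ (kext C T Y Z g) (Comp C ?TX ?TTY ?TY (mmult T Y) ?Tf)"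
    unfolding nat using ob Tf mu h by (intro Comp_assoc) auto
  finally show ?thesis by (simp add: kext_def)
qed

text \<open>Since Kleisli composition is composition with an extended morphism, the category laws
  are the three laws of extension.\<close>

lemma category_Kleisli: "category (Kleisli C T)"
proof
  fix W X Y Z f g h
  assume "W \<in> Ob (Kleisli C T)" "X \<in> Ob (Kleisli C T)" "Y \<in> Ob (Kleisli C T)" "Z \<in> Ob (Kleisli C T)"
    "f \<in> Hom (Kleisli C T) W X" "g \<in> Hom (Kleisli C T) X Y" "h \<in> Hom (Kleisli C T) Y Z"
  then show "Comp (Kleisli C T) W X Z (Comp (Kleisli C T) X Y Z h g) f
      = Comp (Kleisli C T) W Y Z h (Comp (Kleisli C T) W X Y g f)"
    unfolding Comp_Kleisli_kext
    by (simp add: Kleisli_simps(1-3) kext_Comp_kext)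
      (rule Comp_assoc, auto simp: fobj_in_Ob kext_in_Hom)
qed (auto simp: Kleisli_simps(1-3) Comp_Kleisli_kext munit_in_Hom kext_munit Comp_Id_left
    Comp_kext_munit fobj_in_Ob kext_in_Hom intro!: Comp_in_Hom)

lemma Kleisli_sharp_Comp:
  assumes "X \<in> Ob C" "Y \<in> Ob C" "h \<in> Hom C X Y"
  shows "Comp (Kleisli C T) W X Y (sharp C T X Y h) \<alpha> = Comp C W (fobj T X) (fobj T Y) (farr T X Y h) \<alpha>"
  using assms by (simp add: Comp_Kleisli_kext kext_sharp)

text \<open>Multiplicativity of extension with one factor of the form \<open>sharp\<close>, whose
  extension is \<open>farr\<close>. This lemma and the next rewrite the two sides of a square over
  \<open>h\<close> as extensions.\<close>

lemma farr_Comp_kext: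
  assumes "W \<in> Ob C" "X \<in> Ob C" "Y \<in> Ob C" "\<alpha> \<in> Hom C W (fobj T X)" "h \<in> Hom C X Y"
  shows "Comp C (fobj T W) (fobj T X) (fobj T Y) (farr T X Y h) (kext C T W X \<alpha>)
    = kext C T W Y (Comp C W (fobj T X) (fobj T Y) (farr T X Y h) \<alpha>)"
  using kext_Comp_kext[of W X Y \<alpha> "sharp C T X Y h"] assms by (simp add: kext_sharp sharp_in_Hom)

lemma kext_Comp_farr:
  assumes "X \<in> Ob C" "Y \<in> Ob C" "Z \<in> Ob C" "h \<in> Hom C X Y" "\<beta> \<in> Hom C Y (fobj T Z)"
  shows "Comp C (fobj T X) (fobj T Y) (fobj T Z) (kext C T Y Z \<beta>) (farr T X Y h)
    = kext C T X Z (Comp C X Y (fobj T Z) \<beta> h)"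
  using kext_Comp_kext[of X Y Z "sharp C T X Y h" \<beta>] Kleisli_Comp_sharp[of X Y Z h \<beta>] assms
  by (simp add: kext_sharp sharp_in_Hom Comp_Kleisli_kext)

end

section \<open>Monads from Kleisli triples, and the composite monad\<close>

text \<open>Extension operators of two monads compose directly, whereas the multiplication of the
  composite is a nested expression. The monad laws are therefore derived here from the laws of
  extension.\<close>

lemma monadI_kleisli_triple:
  fixes C :: "('o, 'm) cat" and M :: "('o, 'm) monad_data"
    and ext :: "'o \<Rightarrow> 'o \<Rightarrow> 'm \<Rightarrow> 'm"
  assumes "category C"
    and ob: "\<And>X. X \<in> Ob C \<Longrightarrow> fobj M X \<in> Ob C"
    and unit: "\<And>X. X \<in> Ob C \<Longrightarrow> munit M X \<in> Hom C X (fobj M X)"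
    and ext: "\<And>X Y g. \<lbrakk>X \<in> Ob C; Y \<in> Ob C; g \<in> Hom C X (fobj M Y)\<rbrakk>
      \<Longrightarrow> ext X Y g \<in> Hom C (fobj M X) (fobj M Y)"
    and ext_unit: "\<And>X. X \<in> Ob C \<Longrightarrow> ext X X (munit M X) = Id C (fobj M X)"
    and Comp_ext_unit: "\<And>X Y g. \<lbrakk>X \<in> Ob C; Y \<in> Ob C; g \<in> Hom C X (fobj M Y)\<rbrakk>
      \<Longrightarrow> Comp C X (fobj M X) (fobj M Y) (ext X Y g) (munit M X) = g"
    and ext_Comp_ext: "\<And>X Y Z f g.
      \<lbrakk>X \<in> Ob C; Y \<in> Ob C; Z \<in> Ob C; f \<in> Hom C X (fobj M Y); g \<in> Hom C Y (fobj M Z)\<rbrakk>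
      \<Longrightarrow> ext X Z (Comp C X (fobj M Y) (fobj M Z) (ext Y Z g) f)
        = Comp C (fobj M X) (fobj M Y) (fobj M Z) (ext Y Z g) (ext X Y f)"
    and arr: "\<And>X Y f. \<lbrakk>X \<in> Ob C; Y \<in> Ob C; f \<in> Hom C X Y\<rbrakk>
      \<Longrightarrow> farr M X Y f = ext X Y (Comp C X Y (fobj M Y) (munit M Y) f)"
    and mult: "\<And>X. X \<in> Ob C \<Longrightarrow> mmult M X = ext (fobj M X) X (Id C (fobj M X))"
  shows "monad C M"
proof -
  interpret category C by fact
  have sh: "Comp C X Y (fobj M Y) (munit M Y) f \<in> Hom C X (fobj M Y)"
    if "X \<in> Ob C" "Y \<in> Ob C" "f \<in> Hom C X Y" for X Y f
    by (rule Comp_in_Hom) (use that ob unit in auto)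
  have ext_sh: "Comp C X (fobj M Y) (fobj M Z) (ext Y Z g) (Comp C X Y (fobj M Y) (munit M Y) f)
      = Comp C X Y (fobj M Z) g f"
    if "X \<in> Ob C" "Y \<in> Ob C" "Z \<in> Ob C" "f \<in> Hom C X Y" "g \<in> Hom C Y (fobj M Z)" for X Y Z f g
    using that Comp_assoc[of X Y "fobj M Y" "fobj M Z" f "munit M Y" "ext Y Z g"]
    by (simp add: ob unit ext Comp_ext_unit)
  \<comment> \<open>Absorbing the functor action into an extension is the step to which
    functoriality, naturality of the multiplication, associativity and one unit law all
    reduce.\<close>
  have ext_arr: "Comp C (fobj M X) (fobj M Y) (fobj M Z) (ext Y Z g) (farr M X Y f)
      = ext X Z (Comp C X Y (fobj M Z) g f)"
    if "X \<in> Ob C" "Y \<in> Ob C" "Z \<in> Ob C" "f \<in> Hom C X Y" "g \<in> Hom C Y (fobj M Z)" for X Y Z f g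
    using that by (simp add: arr ext_Comp_ext[symmetric] sh ext_sh)
  have Id: "Id C (fobj M X) \<in> Hom C (fobj M X) (fobj M X)" if "X \<in> Ob C" for X
    using that by (simp add: ob Id_in_Hom)
  have mu: "mmult M X \<in> Hom C (fobj M (fobj M X)) (fobj M X)" if "X \<in> Ob C" for X
    using that by (simp add: mult ext ob Id)
  have farr: "farr M X Y f \<in> Hom C (fobj M X) (fobj M Y)"
    if "X \<in> Ob C" "Y \<in> Ob C" "f \<in> Hom C X Y" for X Y f
    using that by (simp add: arr ext sh)
  show ?thesis
  proof
    fix X Y Z f g
    assume a: "X \<in> Ob C" "Y \<in> Ob C" "Z \<in> Ob C" "f \<in> Hom C X Y" "g \<in> Hom C Y Z"
    show "farr M X Z (Comp C X Y Z g f)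
        = Comp C (fobj M X) (fobj M Y) (fobj M Z) (farr M Y Z g) (farr M X Y f)"
      using a ext_arr[of X Y Z f "Comp C Y Z (fobj M Z) (munit M Z) g"]
      by (simp add: sh) (simp add: arr Comp_in_Hom Comp_assoc ob unit)
  next
    fix X Y f
    assume a: "X \<in> Ob C" "Y \<in> Ob C" "f \<in> Hom C X Y"
    show "Comp C X (fobj M X) (fobj M Y) (farr M X Y f) (munit M X)
        = Comp C X Y (fobj M Y) (munit M Y) f"
      using a by (simp add: arr Comp_ext_unit sh)
    let ?h = "Comp C X Y (fobj M Y) (munit M Y) f"
    \<comment> \<open>Both sides of naturality are the extension of \<open>farr M X Y f\<close>,
      since the multiplication extends an identity. Associativity below is treated alike.\<close>
    have "Comp C (fobj M (fobj M X)) (fobj M X) (fobj M Y) (ext X Y ?h) (mmult M X)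
      = ext (fobj M X) Y (ext X Y ?h)"
      using a ext_Comp_ext[of "fobj M X" X Y "Id C (fobj M X)" ?h]
      by (simp add: mult ob sh Id ext Comp_Id_right)
    moreover have "Comp C (fobj M (fobj M X)) (fobj M (fobj M Y)) (fobj M Y)
                (mmult M Y) (farr M (fobj M X) (fobj M Y) (farr M X Y f))
       = ext (fobj M X) Y (farr M X Y f)"
      using a by (simp add: mult ext_arr ob farr Id Comp_Id_left)
    ultimately show "Comp C (fobj M (fobj M X)) (fobj M X) (fobj M Y) (farr M X Y f) (mmult M X)
            = Comp C (fobj M (fobj M X)) (fobj M (fobj M Y)) (fobj M Y)
                (mmult M Y) (farr M (fobj M X) (fobj M Y) (farr M X Y f))"
      using a by (simp add: arr)
  next
    fix X
    assume a: "X \<in> Ob C"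
    show "farr M X X (Id C X) = Id C (fobj M X)"
      using a by (simp add: arr Id_in_Hom Comp_Id_right ob unit ext_unit)
    have "Comp C (fobj M (fobj M (fobj M X))) (fobj M (fobj M X)) (fobj M X)
        (mmult M X) (mmult M (fobj M X)) = ext (fobj M (fobj M X)) X (mmult M X)"
      using a ext_Comp_ext[of "fobj M (fobj M X)" "fobj M X" X "Id C (fobj M (fobj M X))" "Id C (fobj M X)"]
      by (simp add: mult ob Id ext Comp_Id_right)
    moreover have "Comp C (fobj M (fobj M (fobj M X))) (fobj M (fobj M X)) (fobj M X)
              (mmult M X) (farr M (fobj M (fobj M X)) (fobj M X) (mmult M X))
        = ext (fobj M (fobj M X)) X (mmult M X)"
      using a by (simp add: mult[of X] ext_arr ext ob Id Comp_Id_left)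
    ultimately show "Comp C (fobj M (fobj M (fobj M X))) (fobj M (fobj M X)) (fobj M X)
              (mmult M X) (farr M (fobj M (fobj M X)) (fobj M X) (mmult M X))
            = Comp C (fobj M (fobj M (fobj M X))) (fobj M (fobj M X)) (fobj M X)
                (mmult M X) (mmult M (fobj M X))" by simp
    show "Comp C (fobj M X) (fobj M (fobj M X)) (fobj M X) (mmult M X) (munit M (fobj M X))
            = Id C (fobj M X)"
      using a by (simp add: mult Comp_ext_unit ob Id)
    show "Comp C (fobj M X) (fobj M (fobj M X)) (fobj M X)
              (mmult M X) (farr M X (fobj M X) (munit M X)) = Id C (fobj M X)"
      using a by (simp add: mult ext_arr ob Id unit Comp_Id_left ext_unit)
  qed (simp_all add: ob unit mu farr)
qed

text \<open>The extension of the composite is extension for \<open>Sb\<close> followed by extension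
  for \<open>T\<close>, so each law follows by applying the corresponding law of \<open>Sb\<close>
  and then that of \<open>T\<close>.\<close>

lemma monad_composite_monad:
  assumes "monad C T" "endofunctor C S" "monad (Kleisli C T) Sb" "lifts_to C T S Sb"
  shows "monad C (composite_monad C T S Sb)"
proof -
  interpret T: monad C T by fact
  interpret S: endofunctor C S by fact
  interpret Sb: monad "Kleisli C T" Sb by fact
  let ?K = "Kleisli C T" and ?M = "composite_monad C T S Sb"
  let ?ext = "\<lambda>X Y g. kext C T (fobj S X) (fobj S Y) (kext ?K Sb X Y g)"
  have Sb_S: "fobj Sb X = fobj S X" if "X \<in> Ob C" for X
    using that assms by (simp add: lifts_to_def)
  have M: "fobj ?M X = fobj T (fobj S X)" "munit ?M X = munit Sb X" for X
    by (simp_all add: composite_monad_def)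
  have ob: "fobj S X \<in> Ob C" if "X \<in> Ob C" for X using that by (rule S.fobj_in_Ob)
  have unit: "munit Sb X \<in> Hom C X (fobj T (fobj S X))" if "X \<in> Ob C" for X
    using that Sb.munit_in_Hom[of X] by (simp add: Kleisli_simps Sb_S)
  have inner: "kext ?K Sb X Y g \<in> Hom C (fobj S X) (fobj T (fobj S Y))"
    if "X \<in> Ob C" "Y \<in> Ob C" "g \<in> Hom C X (fobj T (fobj S Y))" for X Y g
    using that Sb.kext_in_Hom[of X Y g] by (simp add: Kleisli_simps(1-3) Sb_S)
  show ?thesis
  proof (rule monadI_kleisli_triple[where ext = ?ext])
    fix X assume X: "X \<in> Ob C"
    show "?ext X X (munit ?M X) = Id C (fobj ?M X)"
      using X Sb.kext_munit[of X] by (simp add: M Kleisli_simps(1-3) Sb_S T.kext_munit ob)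
    show "mmult ?M X = ?ext (fobj ?M X) X (Id C (fobj ?M X))"
      using X by (simp add: composite_monad_def Let_def kext_def Sb_S ob T.fobj_in_Ob)
  next
    fix X Y g assume a: "X \<in> Ob C" "Y \<in> Ob C" "g \<in> Hom C X (fobj ?M Y)"
    show "?ext X Y g \<in> Hom C (fobj ?M X) (fobj ?M Y)"
      using a by (simp add: M T.kext_in_Hom inner ob)
    show "Comp C X (fobj ?M X) (fobj ?M Y) (?ext X Y g) (munit ?M X) = g"
      using a Sb.Comp_kext_munit[of X Y g]
      by (simp add: M Kleisli_simps(1-3) Sb_S Comp_Kleisli_kext)
  next
    fix X Y Z f g
    assume a: "X \<in> Ob C" "Y \<in> Ob C" "Z \<in> Ob C" "f \<in> Hom C X (fobj ?M Y)" "g \<in> Hom C Y (fobj ?M Z)"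
    then show "?ext X Z (Comp C X (fobj ?M Y) (fobj ?M Z) (?ext Y Z g) f)
        = Comp C (fobj ?M X) (fobj ?M Y) (fobj ?M Z) (?ext Y Z g) (?ext X Y f)"
      using Sb.kext_Comp_kext[of X Y Z f g]
      by (simp add: M Kleisli_simps(1-3) Sb_S Comp_Kleisli_kext T.kext_Comp_kext inner ob)
  next
    fix X Y f assume a: "X \<in> Ob C" "Y \<in> Ob C" "f \<in> Hom C X Y"
    \<comment> \<open>The morphism part of the lifting hypothesis enters here: it identifies the
      functor action of the composite with the one given by extension.\<close>
    have "Comp C X Y (fobj ?M Y) (munit ?M Y) f = sharp ?K Sb X Y (sharp C T X Y f)"
      unfolding sharp_def[of ?K] using a T.Kleisli_Comp_sharp[of X Y "fobj S Y" f "munit Sb Y"]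
      by (simp add: M Sb_S ob unit)
    also have "kext ?K Sb X Y \<dots> = sharp C T (fobj S X) (fobj S Y) (farr S X Y f)"
      using a assms(4)
      by (subst Sb.kext_sharp) (auto simp: Kleisli_simps(1-3) T.sharp_in_Hom lifts_to_def)
    finally show "farr ?M X Y f = ?ext X Y (Comp C X Y (fobj ?M Y) (munit ?M Y) f)"
      using a by (simp add: T.kext_sharp ob S.farr_in_Hom) (simp add: composite_monad_def)
  qed (simp_all add: M ob unit T.fobj_in_Ob T.category_axioms)
qed

section \<open>Saturation as the supremum of powers\<close>

primrec cat_power :: "('o, 'm) cat \<Rightarrow> 'o \<Rightarrow> 'm \<Rightarrow> nat \<Rightarrow> 'm" where
  "cat_power K X g 0 = Id K X"
| "cat_power K X g (Suc n) = Comp K X X X g (cat_power K X g n)"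

text \<open>Clauses (1) to (4) for a single endomorphism, stated for an arbitrary category so that
  they can be used in both Kleisli categories. Clause (5) relates different objects and is handled
  separately.\<close>

definition is_saturation ::
  "('o, 'm) cat \<Rightarrow> ('o \<Rightarrow> 'o \<Rightarrow> 'm \<Rightarrow> 'm \<Rightarrow> bool) \<Rightarrow> 'o \<Rightarrow> 'm \<Rightarrow> 'm \<Rightarrow> bool" where
  "is_saturation K le X \<alpha> s \<longleftrightarrow>
    s \<in> Hom K X X \<and> le X X (Id K X) s \<and> le X X \<alpha> s \<and> le X X (Comp K X X X s s) s \<and>
    (\<forall>\<beta> \<in> Hom K X X.
      le X X (Id K X) \<beta> \<and> le X X \<alpha> \<beta> \<and> le X X (Comp K X X X \<beta> \<beta>) \<beta> \<longrightarrow> le X X s \<beta>)"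

lemma (in category) cat_power_in_Hom:
  "\<lbrakk>X \<in> Ob C; g \<in> Hom C X X\<rbrakk> \<Longrightarrow> cat_power C X g n \<in> Hom C X X"
  by (induction n) (simp_all add: Id_in_Hom Comp_in_Hom)

lemma (in category) cat_power_add:
  "\<lbrakk>X \<in> Ob C; g \<in> Hom C X X\<rbrakk>
    \<Longrightarrow> cat_power C X g (m + n) = Comp C X X X (cat_power C X g m) (cat_power C X g n)"
  by (induction m) (simp_all add: Comp_Id_left cat_power_in_Hom Comp_assoc)

context order_enriched
begin

lemma leq_refl: "\<lbrakk>X \<in> Ob K; Y \<in> Ob K; f \<in> Hom K X Y\<rbrakk> \<Longrightarrow> le X Y f f"
  using le_refl by (meson reflp_onD)

lemma leq_trans:
  "\<lbrakk>X \<in> Ob K; Y \<in> Ob K; f \<in> Hom K X Y; g \<in> Hom K X Y; h \<in> Hom K X Y; le X Y f g; le X Y g h\<rbrakk>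
    \<Longrightarrow> le X Y f h"
  using le_trans by (meson transp_onD)

lemma leq_antisym:
  "\<lbrakk>X \<in> Ob K; Y \<in> Ob K; f \<in> Hom K X Y; g \<in> Hom K X Y; le X Y f g; le X Y g f\<rbrakk> \<Longrightarrow> f = g"
  using le_antisym by (meson antisymp_onD)

lemma is_lub_unique:
  assumes "X \<in> Ob K" "Y \<in> Ob K" "is_lub K le X Y A s" "is_lub K le X Y A t"
  shows "s = t"
  using assms by (intro leq_antisym[of X Y]) (auto simp: is_lub_def)

text \<open>\<open>join\<close> is a definite description; it is meaningful because suprema of
  finite sets exist by hypothesis and are unique by antisymmetry.\<close>

lemma is_lub_join:
  assumes "has_finite_joins K le" "X \<in> Ob K" "Y \<in> Ob K" "f \<in> Hom K X Y" "g \<in> Hom K X Y"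
  shows "is_lub K le X Y {f, g} (join K le X Y f g)"
proof -
  obtain s where s: "is_lub K le X Y {f, g} s"
    using assms unfolding has_finite_joins_def
    by (metis empty_subsetI finite.emptyI finite.insertI insert_subset)
  then show ?thesis
    unfolding join_def by (rule theI) (use s assms is_lub_unique in blast)
qed

lemma is_saturation_unique:
  assumes "X \<in> Ob K" "is_saturation K le X \<alpha> s" "is_saturation K le X \<alpha> t"
  shows "s = t"
  using assms by (intro leq_antisym[of X X]) (auto simp: is_saturation_def)

lemma ascending_chain_cat_power:
  assumes "X \<in> Ob K" "g \<in> Hom K X X" "le X X (Id K X) g"
  shows "ascending_chain K le X X (cat_power K X g)"
  unfolding ascending_chain_def
proof (intro allI conjI)
  fix n
  have p: "cat_power K X g n \<in> Hom K X X" using assms by (simp add: cat_power_in_Hom)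
  then have "le X X (Comp K X X X (Id K X) (cat_power K X g n)) (Comp K X X X g (cat_power K X g n))"
    using assms by (intro Comp_mono) (auto simp: Id_in_Hom leq_refl)
  then show "le X X (cat_power K X g n) (cat_power K X g (Suc n))"
    using p assms by (simp add: Comp_Id_left)
qed (use assms in \<open>simp add: cat_power_in_Hom\<close>)

text \<open>A single inequality becomes the chain \<open>f, g, g, ...\<close>, to which hypotheses
  about chains apply.\<close>

lemma is_lub_constant_tail:
  assumes "X \<in> Ob K" "Y \<in> Ob K" "f \<in> Hom K X Y" "g \<in> Hom K X Y" "le X Y f g"
  shows "ascending_chain K le X Y (\<lambda>i. if i = 0 then f else g)"
    and "is_lub K le X Y (range (\<lambda>i::nat. if i = 0 then f else g)) g"
  using assms by (auto simp: ascending_chain_def is_lub_def leq_refl)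

text \<open>The image of the chain \<open>f, g, g, ...\<close> has supremum \<open>F g\<close> by
  continuity and contains \<open>F f\<close> at index 0.\<close>

lemma locally_continuous_mono:
  assumes "locally_continuous K le F" "X \<in> Ob K" "Y \<in> Ob K" "f \<in> Hom K X Y" "g \<in> Hom K X Y" "le X Y f g"
  shows "le (fobj F X) (fobj F Y) (farr F X Y f) (farr F X Y g)"
proof -
  let ?c = "\<lambda>i::nat. if i = 0 then f else g"
  have "is_lub K le (fobj F X) (fobj F Y) (range (\<lambda>i. farr F X Y (?c i))) (farr F X Y g)"
    using assms is_lub_constant_tail[of X Y f g] unfolding locally_continuous_def by blast
  then have "le (fobj F X) (fobj F Y) (farr F X Y (?c 0)) (farr F X Y g)"
    unfolding is_lub_def by blast
  then show ?thesis by simp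
qed

end

text \<open>Taking powers of \<open>g = 1 \<or> \<alpha>\<close> rather than of
  \<open>\<alpha>\<close> makes them a chain, so \<open>\<omega>\<close>-suprema suffice and
  composition need not preserve joins.\<close>

lemma (in omega_cpo_enriched) is_saturation_lub_cat_power:
  assumes X: "X \<in> Ob K" and \<alpha>: "\<alpha> \<in> Hom K X X"
    and g: "is_lub K le X X {Id K X, \<alpha>} g"
    and s: "is_lub K le X X (range (cat_power K X g)) s"
  shows "is_saturation K le X \<alpha> s"
proof -
  let ?p = "cat_power K X g"
  have g': "g \<in> Hom K X X" "le X X (Id K X) g" "le X X \<alpha> g"
    using g by (auto simp: is_lub_def)
  have s': "s \<in> Hom K X X" using s by (simp add: is_lub_def)
  have p: "?p n \<in> Hom K X X" for n using X g' by (simp add: cat_power_in_Hom)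
  have ps: "le X X (?p n) s" for n using s by (simp add: is_lub_def)
  have chain: "ascending_chain K le X X ?p" using X g' by (simp add: ascending_chain_cat_power)
  have gs: "le X X g s" using ps[of 1] X g' by (simp add: Comp_Id_right)
  \<comment> \<open>Continuity in the left and then in the right argument reduces
    \<open>s \<cdot> s \<le> s\<close> to the bounds \<open>?p (i + j) \<le> s\<close>.\<close>
  have "is_lub K le X X (range (\<lambda>i. Comp K X X X (?p i) s)) (Comp K X X X s s)"
    using X s' chain s by (intro Comp_lub_left)
  moreover have "le X X (Comp K X X X (?p i) s) s" for i
  proof -
    have "is_lub K le X X (range (\<lambda>j. Comp K X X X (?p i) (?p j))) (Comp K X X X (?p i) s)"
      using X p chain s by (intro Comp_lub_right)
    then have "is_lub K le X X (range (\<lambda>j. ?p (i + j))) (Comp K X X X (?p i) s)"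
      using X g' by (simp add: cat_power_add)
    then show ?thesis using s' ps by (auto simp: is_lub_def)
  qed
  ultimately have "le X X (Comp K X X X s s) s"
    using s' by (auto simp: is_lub_def)
  moreover have "le X X s \<beta>"
    if b: "\<beta> \<in> Hom K X X" "le X X (Id K X) \<beta>" "le X X \<alpha> \<beta>" "le X X (Comp K X X X \<beta> \<beta>) \<beta>" for \<beta>
  proof -
    have gb: "le X X g \<beta>" using g b by (auto simp: is_lub_def)
    \<comment> \<open>Minimality: each further factor \<open>g \<le> \<beta>\<close> is absorbed by
      \<open>\<beta> \<cdot> \<beta> \<le> \<beta>\<close>.\<close>
    have "le X X (?p n) \<beta>" for n
    proof (induction n)
      case (Suc n)
      have "le X X (Comp K X X X g (?p n)) (Comp K X X X \<beta> \<beta>)"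
        using X g' p b gb Suc by (intro Comp_mono)
      then show ?case
        using X g' p[of "Suc n"] b leq_trans[of X X "?p (Suc n)" "Comp K X X X \<beta> \<beta>" \<beta>]
        by (simp add: Comp_in_Hom)
    qed (use b in simp)
    then show ?thesis using s b by (auto simp: is_lub_def)
  qed
  moreover have "le X X \<alpha> s" using leq_trans[of X X \<alpha> g s] X \<alpha> g' s' gs by simp
  ultimately show ?thesis using s' ps[of 0] by (simp add: is_saturation_def)
qed

section \<open>The Kleisli category of a locally continuous monad\<close>

text \<open>The enrichment is on the category carrying the monad, not on its Kleisli category. The
  intended instance has \<open>Kleisli C T\<close> for \<open>C\<close> and \<open>Sb\<close> for
  \<open>T\<close>.\<close>

locale locally_continuous_monad = monad C T + omega_cpo_enriched C le
  for C :: "('o, 'm) cat" and T :: "('o, 'm) monad_data" and le +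
  assumes cont: "locally_continuous C le T"
begin

lemma kext_mono:
  assumes "X \<in> Ob C" "Y \<in> Ob C" "f \<in> Hom C X (fobj T Y)" "g \<in> Hom C X (fobj T Y)" "le X (fobj T Y) f g"
  shows "le (fobj T X) (fobj T Y) (kext C T X Y f) (kext C T X Y g)"
  unfolding kext_def using assms
  by (intro Comp_mono) (auto simp: fobj_in_Ob farr_in_Hom mmult_in_Hom leq_refl
      locally_continuous_mono[OF cont])

lemma kext_chain:
  assumes "X \<in> Ob C" "Y \<in> Ob C" "ascending_chain C le X (fobj T Y) c"
  shows "ascending_chain C le (fobj T X) (fobj T Y) (\<lambda>i. kext C T X Y (c i))"
  using assms by (simp add: ascending_chain_def kext_in_Hom kext_mono)

text \<open>Local continuity passes the supremum through the functor, and continuity of composition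
  passes it through the multiplication.\<close>

lemma kext_lub:
  assumes "X \<in> Ob C" "Y \<in> Ob C" "ascending_chain C le X (fobj T Y) c"
    and "is_lub C le X (fobj T Y) (range c) s"
  shows "is_lub C le (fobj T X) (fobj T Y) (range (\<lambda>i. kext C T X Y (c i))) (kext C T X Y s)"
  unfolding kext_def
proof (rule Comp_lub_right)
  show "ascending_chain C le (fobj T X) (fobj T (fobj T Y)) (\<lambda>i. farr T X (fobj T Y) (c i))"
    using assms locally_continuous_mono[OF cont, of X "fobj T Y"]
    by (simp add: ascending_chain_def farr_in_Hom fobj_in_Ob)
  show "is_lub C le (fobj T X) (fobj T (fobj T Y)) (range (\<lambda>i. farr T X (fobj T Y) (c i)))
      (farr T X (fobj T Y) s)"
    using assms cont fobj_in_Ob unfolding locally_continuous_def by blast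
qed (use assms in \<open>auto simp: fobj_in_Ob mmult_in_Hom\<close>)

lemma Kleisli_is_lub: "is_lub (Kleisli C T) (\<lambda>X Y. le X (fobj T Y)) X Y = is_lub C le X (fobj T Y)"
  by (intro ext) (simp add: is_lub_def Kleisli_simps(1-3))

lemma Kleisli_ascending_chain:
  "ascending_chain (Kleisli C T) (\<lambda>X Y. le X (fobj T Y)) X Y = ascending_chain C le X (fobj T Y)"
  by (intro ext) (simp add: ascending_chain_def Kleisli_simps(1-3))

text \<open>Continuity in the outer factor is where extension must preserve suprema
  (\<open>kext_lub\<close>); in the inner factor it is continuity of composition in
  \<open>C\<close>.\<close>

lemma omega_cpo_enriched_Kleisli: "omega_cpo_enriched (Kleisli C T) (\<lambda>X Y. le X (fobj T Y))"
proof -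
  interpret L: category "Kleisli C T" by (rule category_Kleisli)
  show ?thesis
  proof
    fix X Y Z f f' g g'
    assume "X \<in> Ob (Kleisli C T)" "Y \<in> Ob (Kleisli C T)" "Z \<in> Ob (Kleisli C T)"
      "f \<in> Hom (Kleisli C T) X Y" "f' \<in> Hom (Kleisli C T) X Y"
      "g \<in> Hom (Kleisli C T) Y Z" "g' \<in> Hom (Kleisli C T) Y Z"
      "le X (fobj T Y) f f'" "le Y (fobj T Z) g g'"
    then show "le X (fobj T Z) (Comp (Kleisli C T) X Y Z g f) (Comp (Kleisli C T) X Y Z g' f')"
      unfolding Comp_Kleisli_kext
      by (intro Comp_mono) (auto simp: Kleisli_simps(1-3) fobj_in_Ob kext_in_Hom kext_mono)
  next
    fix X Y Z f c s
    assume "X \<in> Ob (Kleisli C T)" "Y \<in> Ob (Kleisli C T)" "Z \<in> Ob (Kleisli C T)"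
      "f \<in> Hom (Kleisli C T) X Y"
      "ascending_chain (Kleisli C T) (\<lambda>X Y. le X (fobj T Y)) Y Z c"
      "is_lub (Kleisli C T) (\<lambda>X Y. le X (fobj T Y)) Y Z (range c) s"
    then show "is_lub (Kleisli C T) (\<lambda>X Y. le X (fobj T Y)) X Z
        (range (\<lambda>i. Comp (Kleisli C T) X Y Z (c i) f)) (Comp (Kleisli C T) X Y Z s f)"
      unfolding Comp_Kleisli_kext Kleisli_is_lub Kleisli_ascending_chain
      by (intro Comp_lub_left kext_chain kext_lub) (auto simp: Kleisli_simps(1-3) fobj_in_Ob)
  next
    fix X Y Z g c s
    assume "X \<in> Ob (Kleisli C T)" "Y \<in> Ob (Kleisli C T)" "Z \<in> Ob (Kleisli C T)"
      "g \<in> Hom (Kleisli C T) Y Z"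
      "ascending_chain (Kleisli C T) (\<lambda>X Y. le X (fobj T Y)) X Y c"
      "is_lub (Kleisli C T) (\<lambda>X Y. le X (fobj T Y)) X Y (range c) s"
    then show "is_lub (Kleisli C T) (\<lambda>X Y. le X (fobj T Y)) X Z
        (range (\<lambda>i. Comp (Kleisli C T) X Y Z g (c i))) (Comp (Kleisli C T) X Y Z g s)"
      unfolding Comp_Kleisli_kext Kleisli_is_lub Kleisli_ascending_chain
      by (intro Comp_lub_right) (auto simp: Kleisli_simps(1-3) fobj_in_Ob kext_in_Hom)
  next
    fix X Y c
    assume "X \<in> Ob (Kleisli C T)" "Y \<in> Ob (Kleisli C T)"
      "ascending_chain (Kleisli C T) (\<lambda>X Y. le X (fobj T Y)) X Y c"
    then show "\<exists>s. is_lub (Kleisli C T) (\<lambda>X Y. le X (fobj T Y)) X Y (range c) s"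
      unfolding Kleisli_is_lub Kleisli_ascending_chain
      by (intro chain_has_lub) (auto simp: Kleisli_simps(1-3) fobj_in_Ob)
  qed (auto simp: Kleisli_simps(1-3) fobj_in_Ob le_refl le_trans le_antisym)
qed

text \<open>Extension preserves identities and composition, hence powers.\<close>

lemma kext_cat_power:
  assumes "X \<in> Ob C" "g \<in> Hom C X (fobj T X)"
  shows "kext C T X X (cat_power (Kleisli C T) X g n) = cat_power C (fobj T X) (kext C T X X g) n"
proof (induction n)
  case (Suc n)
  interpret L: category "Kleisli C T" by (rule category_Kleisli)
  have "cat_power (Kleisli C T) X g n \<in> Hom C X (fobj T X)"
    using L.cat_power_in_Hom[of X g n] assms by (simp add: Kleisli_simps(1-3))
  then show ?case using assms Suc by (simp add: Comp_Kleisli_kext kext_Comp_kext)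
qed (use assms in \<open>simp add: Kleisli_simps(1-3) kext_munit\<close>)

text \<open>One witness \<open>s\<close>, the supremum of the powers of
  \<open>e \<or> \<alpha>\<close>, must serve both claims: its extension is the supremum of the
  powers of the extended join.\<close>

lemma ex_Kleisli_saturation:
  assumes "has_finite_joins C le" and X: "X \<in> Ob C" and \<alpha>: "\<alpha> \<in> Hom C X (fobj T X)"
    and join: "join C le (fobj T X) (fobj T X) (Id C (fobj T X)) (kext C T X X \<alpha>)
      = kext C T X X (join C le X (fobj T X) (munit T X) \<alpha>)"
  shows "\<exists>s. is_saturation (Kleisli C T) (\<lambda>X Y. le X (fobj T Y)) X \<alpha> s \<and>
    is_saturation C le (fobj T X) (kext C T X X \<alpha>) (kext C T X X s)"
proof -
  interpret L: omega_cpo_enriched "Kleisli C T" "\<lambda>X Y. le X (fobj T Y)"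
    by (rule omega_cpo_enriched_Kleisli)
  define g where "g = join C le X (fobj T X) (munit T X) \<alpha>"
  have TX: "fobj T X \<in> Ob C" using X by (rule fobj_in_Ob)
  have g: "is_lub C le X (fobj T X) {munit T X, \<alpha>} g"
    unfolding g_def using assms TX by (intro is_lub_join) (auto simp: munit_in_Hom)
  \<comment> \<open>The hypothesis on joins is needed exactly here, to recognise the extension of
    \<open>g\<close> as the join of the identity with the extension of
    \<open>\<alpha>\<close>.\<close>
  have kg: "is_lub C le (fobj T X) (fobj T X) {Id C (fobj T X), kext C T X X \<alpha>} (kext C T X X g)"
    unfolding g_def join[symmetric] using assms TX
    by (intro is_lub_join) (auto simp: Id_in_Hom kext_in_Hom)
  have gH: "g \<in> Hom C X (fobj T X)" "le X (fobj T X) (munit T X) g" using g by (auto simp: is_lub_def)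
  let ?p = "cat_power (Kleisli C T) X g"
  have chain: "ascending_chain C le X (fobj T X) ?p"
    using L.ascending_chain_cat_power[of X g] X gH
    by (simp add: Kleisli_simps(1-3) Kleisli_ascending_chain)
  obtain s where s: "is_lub C le X (fobj T X) (range ?p) s"
    using chain_has_lub[OF X TX chain] by blast
  have "is_saturation (Kleisli C T) (\<lambda>X Y. le X (fobj T Y)) X \<alpha> s"
    by (rule L.is_saturation_lub_cat_power[where g = g])
      (use X \<alpha> g s in \<open>auto simp: Kleisli_is_lub Kleisli_simps(1-3)\<close>)
  moreover have "is_saturation C le (fobj T X) (kext C T X X \<alpha>) (kext C T X X s)"
    by (rule is_saturation_lub_cat_power[OF TX _ kg])
      (use kext_lub[OF X X chain s] X \<alpha> gH in \<open>auto simp: kext_cat_power kext_in_Hom\<close>)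
  ultimately show ?thesis by blast
qed

text \<open>Kleisli extension is an order embedding, since precomposition with the unit inverts it.\<close>

lemma Kleisli_lax_square:
  assumes "X \<in> Ob C" "Y \<in> Ob C" "h \<in> Hom C X Y" "s \<in> Hom C X (fobj T X)" "t \<in> Hom C Y (fobj T Y)"
  shows "le (fobj T X) (fobj T Y)
      (Comp C (fobj T X) (fobj T X) (fobj T Y) (farr T X Y h) (kext C T X X s))
      (Comp C (fobj T X) (fobj T Y) (fobj T Y) (kext C T Y Y t) (farr T X Y h))
    \<longleftrightarrow> le X (fobj T Y) (Comp (Kleisli C T) X X Y (sharp C T X Y h) s)
      (Comp (Kleisli C T) X Y Y t (sharp C T X Y h))" (is "le _ _ ?A ?B \<longleftrightarrow> le _ _ ?a ?b")
    and "le (fobj T X) (fobj T Y)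
      (Comp C (fobj T X) (fobj T Y) (fobj T Y) (kext C T Y Y t) (farr T X Y h))
      (Comp C (fobj T X) (fobj T X) (fobj T Y) (farr T X Y h) (kext C T X X s))
    \<longleftrightarrow> le X (fobj T Y) (Comp (Kleisli C T) X Y Y t (sharp C T X Y h))
      (Comp (Kleisli C T) X X Y (sharp C T X Y h) s)"
proof -
  have ob: "fobj T X \<in> Ob C" "fobj T Y \<in> Ob C" using assms by (simp_all add: fobj_in_Ob)
  have a: "?a \<in> Hom C X (fobj T Y)" and b: "?b \<in> Hom C X (fobj T Y)"
    using assms ob
    by (auto simp: Kleisli_sharp_Comp Kleisli_Comp_sharp farr_in_Hom intro!: Comp_in_Hom)
  \<comment> \<open>Each side of the square between \<open>fobj T X\<close> and
    \<open>fobj T Y\<close> is the extension of the matching side in the Kleisli category, so it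
    remains that \<open>kext\<close> preserves and reflects the order.\<close>
  have A: "?A = kext C T X Y ?a" using assms by (simp add: farr_Comp_kext Kleisli_sharp_Comp)
  have B: "?B = kext C T X Y ?b" using assms by (simp add: kext_Comp_farr Kleisli_Comp_sharp)
  have iff: "le (fobj T X) (fobj T Y) (kext C T X Y u) (kext C T X Y v) \<longleftrightarrow> le X (fobj T Y) u v"
    if "u \<in> Hom C X (fobj T Y)" "v \<in> Hom C X (fobj T Y)" for u v
  proof
    assume "le (fobj T X) (fobj T Y) (kext C T X Y u) (kext C T X Y v)"
    then have "le X (fobj T Y) (Comp C X (fobj T X) (fobj T Y) (kext C T X Y u) (munit T X))
        (Comp C X (fobj T X) (fobj T Y) (kext C T X Y v) (munit T X))"
      using assms ob that by (intro Comp_mono) (auto simp: munit_in_Hom kext_in_Hom leq_refl)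
    then show "le X (fobj T Y) u v" using assms that by (simp add: Comp_kext_munit)
  qed (use assms that in \<open>simp add: kext_mono\<close>)
  show "le (fobj T X) (fobj T Y) ?A ?B \<longleftrightarrow> le X (fobj T Y) ?a ?b"
    and "le (fobj T X) (fobj T Y) ?B ?A \<longleftrightarrow> le X (fobj T Y) ?b ?a"
    unfolding A B using a b by (simp_all add: iff)
qed

end

section \<open>Transfer of saturation from \<open>T\<close> to the composite monad\<close>

theorem theorem5p10:
  fixes C :: "('o, 'm) cat"
    and T :: "('o, 'm) monad_data"
    and S :: "('o, 'm) functor_data"
    and Sb :: "('o, 'm) monad_data"
    and le :: "'o \<Rightarrow> 'o \<Rightarrow> 'm \<Rightarrow> 'm \<Rightarrow> bool"
  defines "K \<equiv> Kleisli C T"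
  assumes "ordered_saturation_monad C T le"
    and "endofunctor C S"
    and "lifts_to C T S Sb"
    and "monad K Sb"
    and "omega_cpo_enriched K le"
    and "has_finite_joins K le"
    and "locally_continuous K le Sb"
    and "\<And>X \<alpha>. X \<in> Ob K \<Longrightarrow> \<alpha> \<in> Hom K X (fobj Sb X) \<Longrightarrow>
      join K le (fobj Sb X) (fobj Sb X)
        (Id K (fobj Sb X))
        (Comp K (fobj Sb X) (fobj Sb (fobj Sb X)) (fobj Sb X)
          (mmult Sb X) (farr Sb X (fobj Sb X) \<alpha>))
      = Comp K (fobj Sb X) (fobj Sb (fobj Sb X)) (fobj Sb X)
          (mmult Sb X) (farr Sb X (fobj Sb X) (join K le X (fobj Sb X) (munit Sb X) \<alpha>))"
  shows "ordered_saturation_monad C (composite_monad C T S Sb) (\<lambda>X Y. le X (fobj S Y))"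
proof -
  interpret T: ordered_saturation_monad C T le by fact
  interpret S: endofunctor C S by fact
  interpret Sb: monad K Sb by fact
  interpret K: omega_cpo_enriched K le by fact
  interpret Sb: locally_continuous_monad K Sb le
    by (intro locally_continuous_monad.intro locally_continuous_monad_axioms.intro) fact+
  define M where "M = composite_monad C T S Sb"
  \<comment> \<open>\<open>KM\<close> and \<open>L\<close> present the same Kleisli category, once
    over \<open>C\<close> and once over \<open>K\<close>. They are matched only on objects of
    \<open>C\<close>, where \<open>fobj Sb\<close> and \<open>fobj S\<close> are known to
    agree.\<close>
  define KM where "KM = Kleisli C M"
  define L where "L = Kleisli K Sb"
  let ?leM = "\<lambda>X Y. le X (fobj S Y)" and ?leL = "\<lambda>X Y. le X (fobj Sb Y)"
  have monads: "monad C T" "monad (Kleisli C T) Sb"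
    using T.monad_axioms Sb.monad_axioms by (simp_all add: K_def)
  interpret L: omega_cpo_enriched L ?leL
    unfolding L_def by (rule Sb.omega_cpo_enriched_Kleisli)
  interpret M: monad C M
    unfolding M_def by (rule monad_composite_monad) fact+
  interpret KM: category KM unfolding KM_def by (rule M.category_Kleisli)
  have Ob: "Ob K = Ob C" "Ob L = Ob C" "Ob KM = Ob C"
    by (simp_all add: K_def L_def KM_def Kleisli_simps)
  have SbX: "fobj Sb X = fobj S X" if "X \<in> Ob C" for X
    using that assms(4) by (simp add: lifts_to_def)
  have SX: "fobj S X \<in> Ob C" if "X \<in> Ob C" for X using that by (rule S.fobj_in_Ob)
  have HomL: "Hom L X Y = Hom K X (fobj Sb Y)" for X Y by (simp add: L_def Kleisli_simps)
  have HomKM: "Hom KM X Y = Hom L X Y" if "Y \<in> Ob C" for X Y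
    using that by (simp add: HomL SbX) (simp add: KM_def M_def K_def Hom_Kleisli_composite_monad)
  have IdKM: "Id KM X = Id L X" for X
    by (simp add: KM_def M_def L_def Kleisli_simps(3) composite_monad_def)
  have CompKM: "Comp KM X Y Z g f = Comp L X Y Z g f"
    if "X \<in> Ob C" "Y \<in> Ob C" "Z \<in> Ob C" "f \<in> Hom L X Y" "g \<in> Hom L Y Z" for X Y Z f g
    using that Comp_Kleisli_composite_monad[OF monads(1) assms(3) monads(2) assms(4), of X Y Z f g]
    by (simp add: KM_def M_def L_def Comp_Kleisli_kext[of K] kext_def SbX SX HomL[unfolded L_def] K_def[symmetric]
      Kleisli_simps(2)[of K])
  have sharp_T: "sharp C T X Y f \<in> Hom K X Y"
    if "X \<in> Ob C" "Y \<in> Ob C" "f \<in> Hom C X Y" for X Y f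
    using that by (simp add: K_def Kleisli_simps(2) T.sharp_in_Hom)
  have sharpM: "sharp C M X Y f = sharp K Sb X Y (sharp C T X Y f)"
    if "X \<in> Ob C" "Y \<in> Ob C" "f \<in> Hom C X Y" for X Y f
    unfolding sharp_def[of K] M_def
    using that sharp_composite_monad[OF monads assms(4), of X Y f] by (simp add: SbX K_def)
  have sharpL: "sharp K Sb X Y (sharp C T X Y f) \<in> Hom L X Y"
    if "X \<in> Ob C" "Y \<in> Ob C" "f \<in> Hom C X Y" for X Y f
    using that by (simp add: HomL Sb.sharp_in_Hom Ob sharp_T)
  have farr_sharp: "farr Sb X Y (sharp C T X Y f) = sharp C T (fobj S X) (fobj S Y) (farr S X Y f)"
    if "X \<in> Ob C" "Y \<in> Ob C" "f \<in> Hom C X Y" for X Y f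
    using that assms(4) by (simp add: lifts_to_def)

  obtain star where star: "saturation_operator C T le star" using T.has_saturation by blast
  have starT: "is_saturation K le X \<alpha> (star X \<alpha>)" if "X \<in> Ob C" "\<alpha> \<in> Hom K X X" for X \<alpha>
    using star that by (simp add: saturation_operator_def Let_def is_saturation_def K_def)
  \<comment> \<open>Both properties are kept under one existential so that the operator
    \<open>st\<close> chosen next has them simultaneously.\<close>
  have "\<exists>s. is_saturation L ?leL X \<alpha> s \<and>
      is_saturation K le (fobj Sb X) (kext K Sb X X \<alpha>) (kext K Sb X X s)"
    if "X \<in> Ob C" "\<alpha> \<in> Hom L X X" for X \<alpha>
    unfolding L_def
    by (rule Sb.ex_Kleisli_saturation) (use that assms(7,9) in \<open>simp_all add: Ob HomL kext_def\<close>)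
  then obtain st where st: "\<And>X \<alpha>. X \<in> Ob C \<Longrightarrow> \<alpha> \<in> Hom L X X \<Longrightarrow> is_saturation L ?leL X \<alpha> (st X \<alpha>)"
    and kst: "\<And>X \<alpha>. X \<in> Ob C \<Longrightarrow> \<alpha> \<in> Hom L X X \<Longrightarrow>
      is_saturation K le (fobj Sb X) (kext K Sb X X \<alpha>) (kext K Sb X X (st X \<alpha>))"
    by metis
  have stL: "st X \<alpha> \<in> Hom L X X" if "X \<in> Ob C" "\<alpha> \<in> Hom L X X" for X \<alpha>
    using st[OF that] by (simp add: is_saturation_def)
  have kL: "kext K Sb X X \<alpha> \<in> Hom K (fobj S X) (fobj S X)" if "X \<in> Ob C" "\<alpha> \<in> Hom L X X" for X \<alpha>
    using that Sb.kext_in_Hom[of X X \<alpha>] by (simp add: Ob HomL SbX)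
  \<comment> \<open>Clauses (1) to (4) determine a saturation uniquely, so the given operator of
    \<open>T\<close> agrees with the extension of \<open>st\<close>.\<close>
  have star_kext: "star (fobj S X) (kext K Sb X X \<alpha>) = kext K Sb X X (st X \<alpha>)"
    if "X \<in> Ob C" "\<alpha> \<in> Hom L X X" for X \<alpha>
    using K.is_saturation_unique[OF _ starT kst] that kL by (simp add: SbX SX Ob)

  have star5:
    "(?leL X Y (Comp L X X Y F \<alpha>) (Comp L X Y Y \<beta> F) \<longrightarrow>
       ?leL X Y (Comp L X X Y F (st X \<alpha>)) (Comp L X Y Y (st Y \<beta>) F)) \<and>
     (?leL X Y (Comp L X Y Y \<beta> F) (Comp L X X Y F \<alpha>) \<longrightarrow>
       ?leL X Y (Comp L X Y Y (st Y \<beta>) F) (Comp L X X Y F (st X \<alpha>)))"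
    if a: "X \<in> Ob C" "Y \<in> Ob C" "f \<in> Hom C X Y" "\<alpha> \<in> Hom L X X" "\<beta> \<in> Hom L Y Y"
      and F: "F = sharp K Sb X Y (sharp C T X Y f)" for X Y f \<alpha> \<beta> F
  proof -
    \<comment> \<open>Clause (5) for \<open>T\<close> covers only morphisms induced from
      \<open>C\<close>. By the lifting hypothesis \<open>?\<phi>\<close> is the image under
      \<open>Sb\<close> of the morphism induced by \<open>f\<close>, so the clause applies to the
      extended square.\<close>
    let ?\<phi> = "sharp C T (fobj S X) (fobj S Y) (farr S X Y f)"
    let ?SX = "fobj S X" and ?SY = "fobj S Y"
    have Sf: "farr S X Y f \<in> Hom C ?SX ?SY" using a by (simp add: S.farr_in_Hom)
    have "(le ?SX ?SY (Comp K ?SX ?SX ?SY ?\<phi> (kext K Sb X X \<alpha>)) (Comp K ?SX ?SY ?SY (kext K Sb Y Y \<beta>) ?\<phi>) \<longrightarrow>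
        le ?SX ?SY (Comp K ?SX ?SX ?SY ?\<phi> (kext K Sb X X (st X \<alpha>)))
          (Comp K ?SX ?SY ?SY (kext K Sb Y Y (st Y \<beta>)) ?\<phi>)) \<and>
      (le ?SX ?SY (Comp K ?SX ?SY ?SY (kext K Sb Y Y \<beta>) ?\<phi>) (Comp K ?SX ?SX ?SY ?\<phi> (kext K Sb X X \<alpha>)) \<longrightarrow>
        le ?SX ?SY (Comp K ?SX ?SY ?SY (kext K Sb Y Y (st Y \<beta>)) ?\<phi>)
          (Comp K ?SX ?SX ?SY ?\<phi> (kext K Sb X X (st X \<alpha>))))"
      using star SX[OF a(1)] SX[OF a(2)] Sf kL[OF a(1,4)] kL[OF a(2,5)]
      unfolding saturation_operator_def Let_def K_def[symmetric]
      by (simp flip: star_kext[OF a(1,4)] star_kext[OF a(2,5)])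
    \<comment> \<open>The order equivalence for squares is used twice: with \<open>\<alpha>\<close>
      and \<open>\<beta>\<close> to extend the premise, and with their saturations to bring the
      conclusion back.\<close>
    then show ?thesis
      using Sb.Kleisli_lax_square[of X Y "sharp C T X Y f" \<alpha> \<beta>]
        Sb.Kleisli_lax_square[of X Y "sharp C T X Y f" "st X \<alpha>" "st Y \<beta>"]
        a stL[OF a(1,4)] stL[OF a(2,5)]
      by (simp add: Ob HomL SbX sharp_T farr_sharp F L_def[symmetric])
  qed

  have "order_enriched KM ?leM"
  proof
    fix X Y Z f f' g g'
    assume "X \<in> Ob KM" "Y \<in> Ob KM" "Z \<in> Ob KM" "f \<in> Hom KM X Y" "f' \<in> Hom KM X Y"
      "g \<in> Hom KM Y Z" "g' \<in> Hom KM Y Z" "?leM X Y f f'" "?leM Y Z g g'"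
    then show "?leM X Z (Comp KM X Y Z g f) (Comp KM X Y Z g' f')"
      using L.Comp_mono[of X Y Z f f' g g'] by (simp add: Ob HomKM CompKM SbX)
  next
    fix X Y assume "X \<in> Ob KM" "Y \<in> Ob KM"
    then show "reflp_on (Hom KM X Y) (?leM X Y)" "transp_on (Hom KM X Y) (?leM X Y)"
      "antisymp_on (Hom KM X Y) (?leM X Y)"
      using L.le_refl[of X Y] L.le_trans[of X Y] L.le_antisym[of X Y] by (simp_all add: Ob HomKM SbX)
  qed
  moreover have "saturation_operator C M ?leM st"
    unfolding saturation_operator_def Let_def KM_def[symmetric]
  proof (intro conjI ballI)
    fix X Y f \<alpha> \<beta>
    assume a: "X \<in> Ob C" "Y \<in> Ob C" "f \<in> Hom C X Y" "\<alpha> \<in> Hom KM X X" "\<beta> \<in> Hom KM Y Y"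
    have b: "\<alpha> \<in> Hom L X X" "\<beta> \<in> Hom L Y Y" using a by (simp_all add: HomKM)
    note s = star5[OF a(1-3) b refl]
    show "?leM X Y (Comp KM X X Y (sharp C M X Y f) \<alpha>) (Comp KM X Y Y \<beta> (sharp C M X Y f)) \<longrightarrow>
          ?leM X Y (Comp KM X X Y (sharp C M X Y f) (st X \<alpha>)) (Comp KM X Y Y (st Y \<beta>) (sharp C M X Y f))"
      "?leM X Y (Comp KM X Y Y \<beta> (sharp C M X Y f)) (Comp KM X X Y (sharp C M X Y f) \<alpha>) \<longrightarrow>
          ?leM X Y (Comp KM X Y Y (st Y \<beta>) (sharp C M X Y f)) (Comp KM X X Y (sharp C M X Y f) (st X \<alpha>))"
      using s a(1-3) b by (simp_all add: sharpM CompKM sharpL stL SbX)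
  next
    fix X \<alpha> assume a: "X \<in> Ob C" "\<alpha> \<in> Hom KM X X"
    then have b: "\<alpha> \<in> Hom L X X" by (simp add: HomKM)
    note s = st[OF a(1) b, unfolded is_saturation_def]
    show "st X \<alpha> \<in> Hom KM X X" "?leM X X (Id KM X) (st X \<alpha>)" "?leM X X \<alpha> (st X \<alpha>)"
      "?leM X X (Comp KM X X X (st X \<alpha>) (st X \<alpha>)) (st X \<alpha>)"
      using s a(1) by (simp_all add: HomKM IdKM CompKM SbX)
    fix \<beta> assume "\<beta> \<in> Hom KM X X"
    then show "?leM X X (Id KM X) \<beta> \<and> ?leM X X \<alpha> \<beta> \<and> ?leM X X (Comp KM X X X \<beta> \<beta>) \<beta>
        \<longrightarrow> ?leM X X (st X \<alpha>) \<beta>"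
      using s a(1) by (simp add: HomKM IdKM CompKM SbX)
  qed
  ultimately show ?thesis
    unfolding M_def[symmetric] KM_def
    by (intro ordered_saturation_monad.intro ordered_saturation_monad_axioms.intro M.monad_axioms) blast+
qed

end
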